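(* Let $k \in \mathbb{N}$. Let $\Gamma$ be a countable discrete abelian group such that $k\Gamma = \{kx : x \in \Gamma\}$ is a subgroup of infinite index in $\Gamma$. Then for every $\varepsilon > 0$ there exists a set $A \subseteq \Gamma$ with $d^*(A) > 1 - \varepsilon$ such that whenever $B \subseteq \Gamma$ and $t \in \Gamma$ satisfy $B^{\oplus k} + t \subseteq A$, the set $B$ is finite.
   Context: A Følner sequence in a countable discrete abelian group $\Gamma$ is a sequence $(\Phi_N)_{N \in \mathbb{N}}$ of finite subsets of $\Gamma$ such that $\lim_{N\to\infty} |(\Phi_N + x) \triangle \Phi_N|/|\Phi_N| = 0$ for every $x \in \Gamma$. For a Følner sequence $\Phi$, $\overline{d}_\Phi(A) = \limsup_{N\to\infty} |A \cap \Phi_N|/|\Phi_N|$, and the upper Banach density is $d^*(A) = \sup_\Phi \overline{d}_\Phi(A)$ over all Følner sequences in $\Gamma$. For $B \subseteq \Gamma$, $B^{\oplus k} = \{\sum_{x \in F} x : F \subseteq B,\ |F| = k\}$, and $B^{\oplus k} + t = \{y + t : y \in B^{\oplus k}\}$. *)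

theory Defs
  imports "HOL-Library.Extended_Real" "HOL-Library.Countable"
begin

definition translate :: "'a::ab_group_add set \<Rightarrow> 'a \<Rightarrow> 'a set" where
  "translate S x = (\<lambda>y. y + x) ` S"

text \<open>Nonemptiness is implicit in the quotients by \<open>card (\<Phi> N)\<close>; it has to be
  explicit here because division by zero is total in HOL.\<close>

definition folner :: "(nat \<Rightarrow> 'a::ab_group_add set) \<Rightarrow> bool" where
  "folner \<Phi> \<longleftrightarrow>
     (\<forall>N. finite (\<Phi> N) \<and> \<Phi> N \<noteq> {}) \<and>
     (\<forall>x. (\<lambda>N. real (card (sym_diff (translate (\<Phi> N) x) (\<Phi> N))) / real (card (\<Phi> N)))
            \<longlonglongrightarrow> 0)"

text \<open>Densities take values in \<^typ>\<open>ereal\<close>, a complete lattice, so that the limit superior and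
  the supremum carry no side conditions.\<close>

definition upper_density :: "(nat \<Rightarrow> 'a::ab_group_add set) \<Rightarrow> 'a set \<Rightarrow> ereal" where
  "upper_density \<Phi> A = limsup (\<lambda>N. ereal (real (card (A \<inter> \<Phi> N)) / real (card (\<Phi> N))))"

definition upper_banach_density :: "'a::ab_group_add set \<Rightarrow> ereal" where
  "upper_banach_density A = (SUP \<Phi> \<in> {\<Phi>. folner \<Phi>}. upper_density \<Phi> A)"

definition distinct_sums :: "nat \<Rightarrow> 'a::ab_group_add set \<Rightarrow> 'a set" where
  "distinct_sums k B = {\<Sum>x\<in>F. x | F. F \<subseteq> B \<and> finite F \<and> card F = k}"

definition multiples :: "nat \<Rightarrow> 'a::ab_group_add set" where
  "multiples k = range (\<lambda>x. \<Sum>i<k. x)"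

definition infinite_index :: "'a::ab_group_add set \<Rightarrow> bool" where
  "infinite_index H \<longleftrightarrow> infinite (range (translate H))"

text \<open>The set of multiples is a subgroup, so \<^const>\<open>infinite_index\<close> is applied to a genuine
  subgroup.\<close>

lemma zero_in_multiples: "0 \<in> multiples k"
  unfolding multiples_def by (rule image_eqI[where x = 0]) auto

lemma add_in_multiples: "a \<in> multiples k \<Longrightarrow> b \<in> multiples k \<Longrightarrow> a + b \<in> multiples k"
  unfolding multiples_def by (auto simp: sum.distrib[symmetric])

lemma uminus_in_multiples: "a \<in> multiples k \<Longrightarrow> - a \<in> multiples k"
  unfolding multiples_def by (auto simp: sum_negf[symmetric])

end

theory Submission
  imports Defs "HOL-Library.FuncSet" "HOL-Real_Asymp.Real_Asymp"
begin

text \<open>If \<open>H\<close> is a subgroup of finite index containing \<open>k\<Gamma>\<close> and \<open>B\<close> is infinite, then infinitely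
  many elements of \<open>B\<close> lie in one coset of \<open>H\<close>, and any \<open>k\<close> of them sum to an element of \<open>H\<close>; so
  \<open>B\<^sup>\<oplus>\<^sup>k + t\<close> meets \<open>t + H\<close> in an infinite set. Enumerating \<open>\<Gamma>\<close> as \<open>t\<^sub>0, t\<^sub>1, \<dots>\<close>, it therefore
  suffices to delete from \<open>\<Gamma>\<close>, for every \<open>n\<close>, a cofinite part of a coset \<open>t\<^sub>n + H\<^sub>n\<close>, where the
  indices of the \<open>H\<^sub>n\<close> grow so fast that the deleted densities have a small sum. Sparing a finite
  part of each coset is essential, since the full cosets \<open>t\<^sub>n + H\<^sub>n\<close> cover \<open>\<Gamma>\<close>; the spared part
  consists of the Folner sets on which the density of \<open>t\<^sub>n + H\<^sub>n\<close> is not yet close to its limit.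
  Subgroups \<open>H\<^sub>n\<close> of large finite index come from Zorn's lemma, as maximal subgroups over \<open>k\<Gamma>\<close>
  that keep a given finite set of cosets of \<open>k\<Gamma>\<close> apart.\<close>

section \<open>Multiples, subgroups and cosets\<close>

definition add_subgroup :: "'a::ab_group_add set \<Rightarrow> bool" where
  "add_subgroup H \<longleftrightarrow> 0 \<in> H \<and> (\<forall>x\<in>H. \<forall>y\<in>H. x - y \<in> H)"

text \<open>The shape is that of \<open>multiples\<close>, so \<open>nsmul k x\<close> is in
  \<open>multiples k\<close> by mere unfolding.\<close>

abbreviation nsmul :: "nat \<Rightarrow> 'a::ab_group_add \<Rightarrow> 'a" where
  "nsmul n x \<equiv> (\<Sum>i<n. x)"

lemma nsmul_add: "nsmul (m + n) x = nsmul m x + nsmul n x"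
  by (induction n) (auto simp: algebra_simps)

lemma nsmul_mult: "nsmul (m * n) x = nsmul m (nsmul n x)"
proof (induction m)
  case (Suc m)
  have "nsmul (Suc m * n) x = nsmul (m * n + n) x" by (simp add: add.commute)
  then show ?case using Suc by (simp only: nsmul_add sum.lessThan_Suc)
qed simp

lemma sum_const_nsmul: "finite F \<Longrightarrow> (\<Sum>x\<in>F. c) = nsmul (card F) c"
  by (induction F rule: finite_induct) (auto simp: add.commute)

lemma add_subgroup_zero: "add_subgroup H \<Longrightarrow> 0 \<in> H"
  and add_subgroup_diff: "add_subgroup H \<Longrightarrow> x \<in> H \<Longrightarrow> y \<in> H \<Longrightarrow> x - y \<in> H"
  by (auto simp: add_subgroup_def)

lemma add_subgroup_uminus: "add_subgroup H \<Longrightarrow> x \<in> H \<Longrightarrow> - x \<in> H"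
  using add_subgroup_diff[of H 0 x] add_subgroup_zero[of H] by simp

lemma add_subgroup_add: "add_subgroup H \<Longrightarrow> x \<in> H \<Longrightarrow> y \<in> H \<Longrightarrow> x + y \<in> H"
  using add_subgroup_diff[of H x "- y"] add_subgroup_uminus[of H y] by simp

lemma add_subgroup_sum:
  "add_subgroup H \<Longrightarrow> (\<And>i. i \<in> I \<Longrightarrow> f i \<in> H) \<Longrightarrow> sum f I \<in> H"
  by (induction I rule: infinite_finite_induct)
    (auto intro: add_subgroup_add add_subgroup_zero)

lemma add_subgroup_multiples: "add_subgroup (multiples k)"
  unfolding add_subgroup_def diff_conv_add_uminus
  by (intro conjI ballI zero_in_multiples add_in_multiples uminus_in_multiples)

lemma translate_mem_iff: "y \<in> translate S x \<longleftrightarrow> y - x \<in> S"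
  by (force simp: translate_def image_iff algebra_simps)

lemma translate_eq_iff:
  assumes "add_subgroup H"
  shows "translate H x = translate H y \<longleftrightarrow> x - y \<in> H"
proof
  assume "translate H x = translate H y"
  moreover have "x \<in> translate H x"
    using assms by (simp add: translate_mem_iff add_subgroup_zero)
  ultimately show "x - y \<in> H" by (simp add: translate_mem_iff)
next
  assume xy: "x - y \<in> H"
  have "z - x \<in> H \<longleftrightarrow> z - y \<in> H" for z
    using add_subgroup_add[OF assms xy, of "z - x"] add_subgroup_diff[OF assms _ xy, of "z - y"]
    by auto
  then show "translate H x = translate H y" by (auto simp: translate_mem_iff)
qed

lemma translate_translate: "translate (translate S x) y = translate S (x + y)"
  by (auto simp: translate_mem_iff algebra_simps)

lemma card_translate: "card (translate S x) = card S"
  unfolding translate_def by (rule card_image) (auto simp: inj_on_def)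

section \<open>Subgroups of large finite index\<close>

text \<open>This is the subgroup generated by \<open>H\<close> and \<open>x\<close>. Natural
  coefficients suffice because \<open>nsmul j x\<close> lies in \<open>H\<close>: modulo
  \<open>H\<close>, \<open>- nsmul b x\<close> equals \<open>nsmul (b * (j - 1)) x\<close>.\<close>

lemma add_subgroup_adjoin:
  assumes H: "add_subgroup H" and j: "j \<ge> 1" "nsmul j x \<in> H"
  shows "add_subgroup {y. \<exists>i. y - nsmul i x \<in> H}"
  unfolding add_subgroup_def
proof (intro conjI ballI)
  show "0 \<in> {y. \<exists>i. y - nsmul i x \<in> H}"
    using H by (auto intro!: exI[of _ 0] simp: add_subgroup_zero)
next
  fix y z assume "y \<in> {y. \<exists>i. y - nsmul i x \<in> H}" "z \<in> {y. \<exists>i. y - nsmul i x \<in> H}"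
  then obtain a b where ab: "y - nsmul a x \<in> H" "z - nsmul b x \<in> H" by auto
  have bj: "nsmul (b * j) x \<in> H"
    unfolding nsmul_mult by (rule add_subgroup_sum[OF H j(2)])
  have "b * j = (b * (j - 1)) + b" using j by (cases j) auto
  then have eq: "nsmul (b * j) x = nsmul (b * (j - 1)) x + nsmul b x"
    by (metis nsmul_add)
  have "(y - nsmul a x) - (z - nsmul b x) - nsmul (b * j) x \<in> H"
    using ab bj H by (blast intro: add_subgroup_diff)
  also have "(y - nsmul a x) - (z - nsmul b x) - nsmul (b * j) x
      = (y - z) - nsmul (a + b * (j - 1)) x"
    unfolding nsmul_add eq by (simp add: algebra_simps)
  finally show "y - z \<in> {y. \<exists>i. y - nsmul i x \<in> H}" by blast
qed

text \<open>By maximality every cyclic subgroup of the quotient by \<^term>\<open>H\<close> that is nontrivial meets the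
  finite set \<^term>\<open>D\<close>. Hence each nonzero \<^term>\<open>j\<close>-torsion element \<^term>\<open>x\<close> solves \<open>i x = d\<close>
  with \<open>0 < i < j\<close> and \<^prop>\<open>d \<in> D\<close>, and for fixed \<open>i\<close>, \<open>d\<close> these solutions differ by
  \<open>i\<close>-torsion: the torsion is finite by induction.\<close>

lemma finite_torsion_of_maximal:
  fixes H :: "'a::ab_group_add set"
  assumes H: "add_subgroup H" and D: "finite D" "H \<inter> D = {}"
    and max: "\<And>H'. add_subgroup H' \<Longrightarrow> H \<subseteq> H' \<Longrightarrow> H' \<inter> D = {} \<Longrightarrow> H' = H"
    and "j \<ge> 1"
  shows "finite (translate H ` {x. nsmul j x \<in> H})"
  using \<open>j \<ge> 1\<close>
proof (induction j rule: less_induct)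
  case (less j)
  let ?S = "\<lambda>i d. {x. nsmul i x - d \<in> H}"
  have fin: "finite (translate H ` ?S i d)" if i: "i \<in> {1..<j}" for i d
  proof (cases "?S i d = {}")
    case False
    then obtain x0 where x0: "nsmul i x0 - d \<in> H" by auto
    have "translate H ` ?S i d \<subseteq> (\<lambda>C. translate C x0) ` translate H ` {x. nsmul i x \<in> H}"
    proof
      fix C assume "C \<in> translate H ` ?S i d"
      then obtain x where x: "C = translate H x" "nsmul i x - d \<in> H" by auto
      have "nsmul i (x - x0) = (nsmul i x - d) - (nsmul i x0 - d)"
        by (simp add: sum_subtractf)
      then have "nsmul i (x - x0) \<in> H" using add_subgroup_diff[OF H x(2) x0] by simp
      moreover have "C = translate (translate H (x - x0)) x0"
        by (simp add: x translate_translate)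
      ultimately show "C \<in> (\<lambda>C. translate C x0) ` translate H ` {x. nsmul i x \<in> H}"
        by blast
    qed
    moreover have "finite (translate H ` {x. nsmul i x \<in> H})"
      using less.IH i by auto
    ultimately show ?thesis using finite_subset by blast
  qed (simp only: image_empty finite.emptyI)
  have "{x. nsmul j x \<in> H} \<subseteq> H \<union> (\<Union>i\<in>{1..<j}. \<Union>d\<in>D. ?S i d)"
  proof
    fix x assume "x \<in> {x. nsmul j x \<in> H}"
    then have x: "nsmul j x \<in> H" by simp
    show "x \<in> H \<union> (\<Union>i\<in>{1..<j}. \<Union>d\<in>D. ?S i d)"
    proof (cases "x \<in> H")
      case False
      define H' where "H' = {y. \<exists>i. y - nsmul i x \<in> H}"
      have sub: "add_subgroup H'"
        unfolding H'_def using add_subgroup_adjoin[OF H less.prems x] .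
      have HH': "H \<subseteq> H'"
        by (auto simp: H'_def intro!: exI[of _ 0])
      have "x \<in> H'"
        using add_subgroup_zero[OF H] by (auto simp: H'_def intro!: exI[of _ 1])
      then have "H' \<inter> D \<noteq> {}" using max[OF sub HH'] False by auto
      then obtain d i where d: "d \<in> D" "d - nsmul i x \<in> H" by (auto simp: H'_def)
      \<comment> \<open>As \<open>nsmul j x\<close> lies in \<open>H\<close>, the coefficient only
        matters modulo \<open>j\<close>. Reducing it puts it below \<open>j\<close>, in reach of the
        induction hypothesis, and it cannot become 0 because \<open>d\<close> is outside
        \<open>H\<close>.\<close>
      define r where "r = i mod j"
      have "i = (i div j) * j + r" by (simp add: r_def)
      then have i: "nsmul i x = nsmul (i div j) (nsmul j x) + nsmul r x"
        by (metis nsmul_add nsmul_mult)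
      have q: "nsmul (i div j) (nsmul j x) \<in> H"
        by (rule add_subgroup_sum[OF H x])
      have "- ((d - nsmul i x) + nsmul (i div j) (nsmul j x)) \<in> H"
        using add_subgroup_uminus[OF H add_subgroup_add[OF H d(2) q]] .
      then have rd: "nsmul r x - d \<in> H" by (simp add: i algebra_simps)
      have "r \<noteq> 0"
      proof
        assume "r = 0"
        then have "d \<in> H" using add_subgroup_uminus[OF H rd] by simp
        then show False using d D by auto
      qed
      moreover have "r < j" using less.prems by (simp add: r_def)
      ultimately show ?thesis using rd d by auto
    qed simp
  qed
  then have "translate H ` {x. nsmul j x \<in> H}
      \<subseteq> translate H ` H \<union> (\<Union>i\<in>{1..<j}. \<Union>d\<in>D. translate H ` ?S i d)"
    unfolding image_UN[symmetric] image_Un[symmetric] by (rule image_mono)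
  moreover have "translate H ` H \<subseteq> {translate H 0}"
    using translate_eq_iff[OF H, of _ 0] by auto
  then have "finite (translate H ` H)" by (rule finite_subset) simp
  then have "finite (translate H ` H \<union> (\<Union>i\<in>{1..<j}. \<Union>d\<in>D. translate H ` ?S i d))"
    using fin D by (intro finite_UnI finite_UN_I) auto
  ultimately show ?case by (rule finite_subset)
qed

text \<open>Zorn's lemma gives a maximal such \<open>H\<close>. The quotient by \<open>H\<close> is
  annihilated by \<open>k\<close>, so it is its own \<open>k\<close>-torsion, which is finite by
  maximality.\<close>

lemma finite_index_subgroup_avoiding:
  fixes K :: "'a::ab_group_add set"
  assumes K: "add_subgroup K" "\<And>x. nsmul k x \<in> K" and k: "k \<ge> 1"
    and D: "finite D" "K \<inter> D = {}"
  obtains H where "add_subgroup H" "K \<subseteq> H" "H \<inter> D = {}" "finite (range (translate H))"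
proof -
  define F where "F = {H. add_subgroup H \<and> K \<subseteq> H \<and> H \<inter> D = {}}"
  have "\<exists>M\<in>F. \<forall>X\<in>F. M \<subseteq> X \<longrightarrow> X = M"
  proof (rule subset_Zorn_nonempty)
    show "F \<noteq> {}" using K D by (auto simp: F_def)
  next
    fix C assume C: "C \<noteq> {}" "subset.chain F C"
    then have CF: "C \<subseteq> F" and tot: "\<And>X Y. X \<in> C \<Longrightarrow> Y \<in> C \<Longrightarrow> X \<subseteq> Y \<or> Y \<subseteq> X"
      by (auto simp: subset_chain_def)
    have "x - y \<in> \<Union>C" if "x \<in> \<Union>C" "y \<in> \<Union>C" for x y
    proof -
      obtain Z where "Z \<in> C" "x \<in> Z" "y \<in> Z" using \<open>x \<in> \<Union>C\<close> \<open>y \<in> \<Union>C\<close> tot by blast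
      then show ?thesis using CF add_subgroup_diff[of Z x y] by (auto simp: F_def)
    qed
    then have "add_subgroup (\<Union>C)"
      unfolding add_subgroup_def using C(1) CF by (force simp: F_def add_subgroup_zero)
    then show "\<Union>C \<in> F" using C(1) CF by (auto simp: F_def)
  qed
  then obtain H where H: "H \<in> F" and max: "\<And>X. X \<in> F \<Longrightarrow> H \<subseteq> X \<Longrightarrow> X = H" by blast
  have "finite (translate H ` {x. nsmul k x \<in> H})"
  proof (rule finite_torsion_of_maximal[where D = D])
    fix H' assume "add_subgroup H'" "H \<subseteq> H'" "H' \<inter> D = {}"
    then show "H' = H" using H max[of H'] by (auto simp: F_def)
  qed (use H D k in \<open>auto simp: F_def\<close>)
  moreover have "{x. nsmul k x \<in> H} = UNIV" using K H by (auto simp: F_def)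
  ultimately show thesis using H that by (auto simp: F_def)
qed

text \<open>Representatives of \<open>m\<close> distinct cosets of \<open>K\<close> stay in distinct
  cosets of \<open>H\<close> if \<open>H\<close> avoids their pairwise differences. The set
  \<open>D\<close> thus certifies that \<open>H\<close> has index at least \<open>m\<close>.\<close>

lemma finite_index_subgroup_large:
  fixes K :: "'a::ab_group_add set"
  assumes K: "add_subgroup K" "\<And>x. nsmul k x \<in> K" and k: "k \<ge> 1"
    and inf: "infinite_index K"
  obtains H D where "add_subgroup H" "K \<subseteq> H" "finite (range (translate H))"
    "finite D" "card D = m" "\<And>x y. x \<in> D \<Longrightarrow> y \<in> D \<Longrightarrow> x - y \<in> H \<Longrightarrow> x = y"
proof -
  obtain T where T: "finite T" "card T = m" "T \<subseteq> range (translate K)"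
    using infinite_arbitrarily_large[of "range (translate K)" m] inf
    by (auto simp: infinite_index_def)
  obtain D where D: "inj_on (translate K) D" "T = translate K ` D"
    using T(3) by (auto simp: subset_image_inj)
  have finD: "finite D" using T(1) D finite_image_iff[OF D(1)] by simp
  have cardD: "card D = m" using T(2) D card_image[OF D(1)] by simp
  define \<Delta> where "\<Delta> = {x - y | x y. x \<in> D \<and> y \<in> D \<and> x \<noteq> y}"
  have "\<Delta> \<subseteq> (\<lambda>(x, y). x - y) ` (D \<times> D)" by (auto simp: \<Delta>_def)
  then have "finite \<Delta>" by (rule finite_subset) (simp add: finD)
  moreover have "K \<inter> \<Delta> = {}"
    using D(1) by (auto simp: \<Delta>_def inj_on_def translate_eq_iff[OF K(1)])
  ultimately obtain H where "add_subgroup H" "K \<subseteq> H" "H \<inter> \<Delta> = {}" "finite (range (translate H))"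
    using finite_index_subgroup_avoiding[OF K k] by blast
  then show thesis using that[of H D] finD cardD by (auto simp: \<Delta>_def)
qed

section \<open>Folner sequences and the density of cosets\<close>

text \<open>A set and its translate have equal size, so the two halves of the symmetric difference
  do as well. One-sided invariance estimates thereby yield those in \<open>folner\<close>.\<close>

lemma card_sym_diff_translate:
  fixes \<Phi> :: "'a::ab_group_add set"
  assumes "finite \<Phi>"
  shows "card (sym_diff (translate \<Phi> x) \<Phi>) = 2 * card (translate \<Phi> x - \<Phi>)"
proof -
  have fin: "finite (translate \<Phi> x)" using assms by (simp add: translate_def)
  have "card (translate \<Phi> x) = card (translate \<Phi> x - \<Phi>) + card (translate \<Phi> x \<inter> \<Phi>)"
    using card_Int_Diff[OF fin, of \<Phi>] by simp
  moreover have "card \<Phi> = card (\<Phi> - translate \<Phi> x) + card (translate \<Phi> x \<inter> \<Phi>)"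
    using card_Int_Diff[OF assms, of "translate \<Phi> x"] by (simp add: Int_commute)
  ultimately have "card (\<Phi> - translate \<Phi> x) = card (translate \<Phi> x - \<Phi>)"
    by (simp add: card_translate)
  moreover have "card (sym_diff (translate \<Phi> x) \<Phi>)
      = card (translate \<Phi> x - \<Phi>) + card (\<Phi> - translate \<Phi> x)"
    using assms fin by (intro card_Un_disjoint) auto
  ultimately show ?thesis by simp
qed

text \<open>The boxes of radius \<open>r\<close> spanned by a finite set grow polynomially in \<open>r\<close>, so some radius
  step enlarges the box by a factor less than \<open>1 + \<delta>\<close>; that box is almost invariant.\<close>

lemma almost_invariant_set_exists:
  fixes S :: "'a::ab_group_add set"
  assumes S: "finite S" and \<delta>: "\<delta> > 0"
  shows "\<exists>\<Phi>. finite \<Phi> \<and> \<Phi> \<noteq> {} \<and>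
           (\<forall>x\<in>S. real (card (translate \<Phi> x - \<Phi>)) \<le> \<delta> * real (card \<Phi>))"
proof -
  \<comment> \<open>The coefficient functions are extensional, so there are exactly
    \<open>(r + 1) ^ card S\<close> of them.\<close>
  define P where "P r = (\<lambda>f. \<Sum>s\<in>S. nsmul (f s) s) ` (S \<rightarrow>\<^sub>E {..r})" for r :: nat
  have finP: "finite (P r)" for r
    unfolding P_def using S by (intro finite_imageI finite_PiE) auto
  have neP: "P r \<noteq> {}" for r
    unfolding P_def by (auto simp: PiE_eq_empty_iff)
  have mono: "P r \<subseteq> P (Suc r)" for r
    unfolding P_def by (intro image_mono PiE_mono) auto
  have step: "translate (P r) x \<subseteq> P (Suc r)" if x: "x \<in> S" for r x
  proof
    fix y assume "y \<in> translate (P r) x"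
    then obtain f where f: "f \<in> S \<rightarrow>\<^sub>E {..r}" "y = (\<Sum>s\<in>S. nsmul (f s) s) + x"
      by (auto simp: translate_def P_def)
    \<comment> \<open>Adding \<open>x\<close> raises its coefficient by one, at the cost of one unit
      of radius.\<close>
    let ?g = "f(x := Suc (f x))"
    have "(\<Sum>s\<in>S. nsmul (?g s) s) = nsmul (?g x) x + (\<Sum>s\<in>S - {x}. nsmul (?g s) s)"
      by (rule sum.remove[OF S x])
    also have "(\<Sum>s\<in>S - {x}. nsmul (?g s) s) = (\<Sum>s\<in>S - {x}. nsmul (f s) s)"
      by (intro sum.cong) auto
    also have "nsmul (?g x) x + \<dots> = (nsmul (f x) x + (\<Sum>s\<in>S - {x}. nsmul (f s) s)) + x"
      by (simp add: algebra_simps)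
    also have "nsmul (f x) x + (\<Sum>s\<in>S - {x}. nsmul (f s) s) = (\<Sum>s\<in>S. nsmul (f s) s)"
      by (rule sum.remove[OF S x, symmetric])
    finally have "y = (\<Sum>s\<in>S. nsmul (?g s) s)" using f by simp
    moreover have "?g \<in> S \<rightarrow>\<^sub>E {..Suc r}"
      using f(1) x by (auto simp: PiE_iff extensional_def le_SucI)
    ultimately show "y \<in> P (Suc r)" unfolding P_def by blast
  qed
  have card_le: "card (P r) \<le> (r + 1) ^ card S" for r
  proof -
    have "card (P r) \<le> card (S \<rightarrow>\<^sub>E {..r})"
      unfolding P_def using S by (intro card_image_le finite_PiE) auto
    then show ?thesis using S by (simp add: card_PiE)
  qed
  have "\<exists>r. real (card (P (Suc r))) \<le> (1 + \<delta>) * real (card (P r))"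
  proof (rule ccontr)
    assume "\<not> ?thesis"
    then have gt: "real (card (P (Suc r))) > (1 + \<delta>) * real (card (P r))" for r
      by (auto simp: not_le)
    have ge: "real (card (P r)) \<ge> (1 + \<delta>) ^ r" for r
    proof (induction r)
      case 0
      have "card (P 0) \<ge> 1" using finP neP by (simp add: Suc_le_eq card_gt_0_iff)
      then show ?case by simp
    next
      case (Suc r)
      have "(1 + \<delta>) ^ Suc r \<le> (1 + \<delta>) * real (card (P r))" using Suc \<delta> by simp
      then show ?case using gt[of r] by linarith
    qed
    have "(\<lambda>r. (real r + 1) ^ card S / (1 + \<delta>) ^ r) \<longlonglongrightarrow> 0"
      using \<delta> by real_asymp
    then have "eventually (\<lambda>r. (real r + 1) ^ card S / (1 + \<delta>) ^ r < 1) sequentially"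
      by (rule order_tendstoD) simp
    then obtain r where "(real r + 1) ^ card S / (1 + \<delta>) ^ r < 1"
      by (auto simp: eventually_sequentially)
    then have "(real r + 1) ^ card S < (1 + \<delta>) ^ r" using \<delta> by (simp add: divide_simps)
    moreover have "real (card (P r)) \<le> (real r + 1) ^ card S"
      using card_le[of r] by (metis of_nat_Suc of_nat_le_iff of_nat_power Suc_eq_plus1 add.commute)
    ultimately show False using ge[of r] by linarith
  qed
  then obtain r where r: "real (card (P (Suc r))) \<le> (1 + \<delta>) * real (card (P r))" ..
  have "real (card (translate (P r) x - P r)) \<le> \<delta> * real (card (P r))" if x: "x \<in> S" for x
  proof -
    have "card (translate (P r) x - P r) \<le> card (P (Suc r) - P r)"
      using step[OF x, of r] finP by (intro card_mono) auto
    also have "\<dots> = card (P (Suc r)) - card (P r)"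
      using mono finP by (intro card_Diff_subset) auto
    finally have "real (card (translate (P r) x - P r)) \<le> real (card (P (Suc r))) - real (card (P r))"
      using card_mono[OF finP mono, of r] by linarith
    then show ?thesis using r by (simp add: algebra_simps)
  qed
  then show ?thesis using finP neP by (intro exI[of _ "P r"]) simp
qed

text \<open>By countability, the \<open>N\<close>-th set can be chosen almost invariant, with error
  \<open>1 / Suc N\<close>, under the elements enumerated up to \<open>N\<close>; each fixed
  \<open>x\<close> is among these from some point on.\<close>

lemma folner_exists:
  obtains \<Phi> :: "nat \<Rightarrow> 'a::{ab_group_add, countable} set" where "folner \<Phi>"
proof -
  have "\<exists>\<Phi> :: 'a set. finite \<Phi> \<and> \<Phi> \<noteq> {} \<and>
          (\<forall>x \<in> from_nat ` {..N}. real (card (translate \<Phi> x - \<Phi>)) \<le> 1 / real (Suc N) * real (card \<Phi>))"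
    for N by (rule almost_invariant_set_exists) auto
  then obtain \<Phi> :: "nat \<Rightarrow> 'a set" where fin: "\<And>N. finite (\<Phi> N)" and ne: "\<And>N. \<Phi> N \<noteq> {}"
    and inv: "\<And>N x. x \<in> from_nat ` {..N} \<Longrightarrow>
      real (card (translate (\<Phi> N) x - \<Phi> N)) \<le> 1 / real (Suc N) * real (card (\<Phi> N))"
    by metis
  have "(\<lambda>N. real (card (sym_diff (translate (\<Phi> N) x) (\<Phi> N))) / real (card (\<Phi> N))) \<longlonglongrightarrow> 0" for x
  proof (rule tendsto_sandwich)
    show "(\<lambda>N::nat. 0 :: real) \<longlonglongrightarrow> 0" by simp
    show "(\<lambda>N::nat. 2 / real (Suc N)) \<longlonglongrightarrow> 0" by real_asymp
    show "\<forall>\<^sub>F N in sequentially.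
        0 \<le> real (card (sym_diff (translate (\<Phi> N) x) (\<Phi> N))) / real (card (\<Phi> N))" by simp
    show "\<forall>\<^sub>F N in sequentially.
        real (card (sym_diff (translate (\<Phi> N) x) (\<Phi> N))) / real (card (\<Phi> N)) \<le> 2 / real (Suc N)"
      using eventually_ge_at_top[of "to_nat x"]
    proof eventually_elim
      case (elim N)
      have "card (\<Phi> N) > 0" using fin ne by (simp add: card_gt_0_iff)
      moreover have "x \<in> from_nat ` {..N}" using elim by (metis atMost_iff from_nat_to_nat imageI)
      note inv[OF this]
      ultimately show ?case
        by (simp add: card_sym_diff_translate[OF fin] divide_simps del: of_nat_Suc)
    qed
  qed
  then have "folner \<Phi>" using fin ne by (simp add: folner_def)
  then show thesis by (rule that)
qed

text \<open>Disjoint translates of the coset by the elements of \<^term>\<open>D\<close> all have nearly the same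
  density along \<^term>\<open>\<Phi>\<close>.\<close>

lemma coset_density_le:
  fixes H :: "'a::ab_group_add set"
  assumes \<Phi>: "folner \<Phi>" and H: "add_subgroup H"
    and D: "finite D" "\<And>x y. x \<in> D \<Longrightarrow> y \<in> D \<Longrightarrow> x - y \<in> H \<Longrightarrow> x = y"
  shows "\<forall>\<^sub>F N in sequentially.
           real (card D) * real (card (\<Phi> N \<inter> translate H t)) \<le> 2 * real (card (\<Phi> N))"
proof -
  have fin: "finite (\<Phi> N)" and ne: "\<Phi> N \<noteq> {}" for N
    using \<Phi> by (auto simp: folner_def)
  \<comment> \<open>The translation errors of all \<open>d\<close> together eventually stay below
    \<open>card (\<Phi> N)\<close>. The disjoint cosets contribute at most as much again, whence the
    constant 2.\<close>
  have "(\<lambda>N. \<Sum>d\<in>D. real (card (sym_diff (translate (\<Phi> N) d) (\<Phi> N))) / real (card (\<Phi> N)))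
          \<longlonglongrightarrow> (\<Sum>d\<in>D. 0)"
    using \<Phi> by (intro tendsto_sum) (auto simp: folner_def)
  then have "\<forall>\<^sub>F N in sequentially.
      (\<Sum>d\<in>D. real (card (sym_diff (translate (\<Phi> N) d) (\<Phi> N))) / real (card (\<Phi> N))) < 1"
    by (rule order_tendstoD) simp
  then show ?thesis
  proof eventually_elim
    case (elim N)
    have pos: "real (card (\<Phi> N)) > 0" using fin ne by (simp add: card_gt_0_iff)
    have "(\<Sum>d\<in>D. real (card (sym_diff (translate (\<Phi> N) d) (\<Phi> N)))) < real (card (\<Phi> N))"
      using elim pos by (simp flip: sum_divide_distrib add: divide_simps)
    then have small: "(\<Sum>d\<in>D. card (sym_diff (translate (\<Phi> N) d) (\<Phi> N))) < card (\<Phi> N)"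
      by (metis of_nat_less_iff of_nat_sum)
    \<comment> \<open>Translation by \<open>d\<close> carries the coset of \<open>t\<close> to that
      of \<open>t + d\<close>; points that leave \<open>\<Phi> N\<close> are counted by the
      symmetric difference.\<close>
    have "card (\<Phi> N \<inter> translate H t)
        \<le> card (\<Phi> N \<inter> translate H (t + d)) + card (sym_diff (translate (\<Phi> N) d) (\<Phi> N))" for d
    proof -
      have "card (\<Phi> N \<inter> translate H t) = card (translate (\<Phi> N \<inter> translate H t) d)"
        by (simp add: card_translate)
      also have "\<dots> \<le> card ((\<Phi> N \<inter> translate H (t + d)) \<union> sym_diff (translate (\<Phi> N) d) (\<Phi> N))"
        using fin by (intro card_mono) (auto simp: translate_mem_iff algebra_simps, simp_all add: translate_def)
      also have "\<dots> \<le> card (\<Phi> N \<inter> translate H (t + d)) + card (sym_diff (translate (\<Phi> N) d) (\<Phi> N))"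
        by (rule card_Un_le)
      finally show ?thesis .
    qed
    then have "(\<Sum>d\<in>D. card (\<Phi> N \<inter> translate H t))
        \<le> (\<Sum>d\<in>D. card (\<Phi> N \<inter> translate H (t + d)) + card (sym_diff (translate (\<Phi> N) d) (\<Phi> N)))"
      by (intro sum_mono)
    also have "\<dots> = (\<Sum>d\<in>D. card (\<Phi> N \<inter> translate H (t + d)))
        + (\<Sum>d\<in>D. card (sym_diff (translate (\<Phi> N) d) (\<Phi> N)))"
      by (rule sum.distrib)
    also have "(\<Sum>d\<in>D. card (\<Phi> N \<inter> translate H (t + d))) = card (\<Union>d\<in>D. \<Phi> N \<inter> translate H (t + d))"
    proof (rule card_UN_disjoint[symmetric])
      have False if "d \<in> D" "e \<in> D" "d \<noteq> e" "y - (t + d) \<in> H" "y - (t + e) \<in> H" for d e y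
      proof -
        have "d - e \<in> H"
          using add_subgroup_diff[OF H that(5,4)] by (simp add: algebra_simps)
        then show False using D(2) that by blast
      qed
      then show "\<forall>d\<in>D. \<forall>e\<in>D. d \<noteq> e \<longrightarrow>
          (\<Phi> N \<inter> translate H (t + d)) \<inter> (\<Phi> N \<inter> translate H (t + e)) = {}"
        by (auto simp: translate_mem_iff)
    qed (use D fin in auto)
    also have "\<dots> \<le> card (\<Phi> N)" using fin by (intro card_mono) auto
    finally have "card D * card (\<Phi> N \<inter> translate H t) \<le> 2 * card (\<Phi> N)"
      using small by simp
    then show ?case by (metis of_nat_le_iff of_nat_mult of_nat_numeral)
  qed
qed

section \<open>Distinct sums in a subgroup of finite index\<close>

text \<open>Inside one coset that contains infinitely many elements of \<open>B\<close>,
  \<open>k - 1\<close> summands are fixed and the last one varies, which produces infinitely many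
  sums.\<close>

lemma infinite_sums_in_subgroup:
  fixes H :: "'a::ab_group_add set"
  assumes H: "add_subgroup H" "finite (range (translate H))" "multiples k \<subseteq> H"
    and k: "k \<ge> 1" and B: "infinite B"
  shows "infinite (distinct_sums k B \<inter> H)"
proof -
  have "finite (translate H ` B)" by (rule finite_subset[OF _ H(2)]) auto
  from pigeonhole_infinite[OF B this]
  obtain c0 where c0: "c0 \<in> B" "infinite {c \<in> B. translate H c = translate H c0}"
    by auto
  define C where "C = {c \<in> B. translate H c = translate H c0}"
  obtain F0 where F0: "finite F0" "card F0 = k - 1" "F0 \<subseteq> C"
    using infinite_arbitrarily_large[of C "k - 1"] c0 by (auto simp: C_def)
  have "(\<lambda>c. \<Sum>F0 + c) ` (C - F0) \<subseteq> distinct_sums k B \<inter> H"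
  proof
    fix y assume "y \<in> (\<lambda>c. \<Sum>F0 + c) ` (C - F0)"
    then obtain c where c: "c \<in> C" "c \<notin> F0" "y = \<Sum>F0 + c" by auto
    define F where "F = insert c F0"
    have F: "finite F" "card F = k" "F \<subseteq> C" using F0 c k by (auto simp: F_def)
    have y: "y = (\<Sum>x\<in>F. x)" using F0 c by (simp add: F_def add.commute)
    \<comment> \<open>The sum is compared with \<open>k\<close> copies of \<open>c0\<close>: the
      differences lie in \<open>H\<close>, and so does \<open>nsmul k c0\<close>.\<close>
    have "(\<Sum>x\<in>F. x - c0) \<in> H"
      using F by (intro add_subgroup_sum[OF H(1)]) (auto simp: C_def translate_eq_iff[OF H(1)])
    moreover have "(\<Sum>x\<in>F. c0) = nsmul k c0"
      using sum_const_nsmul[OF F(1), of c0] F(2) by simp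
    moreover have "nsmul k c0 \<in> H" using H(3) by (auto simp: multiples_def)
    ultimately have "(\<Sum>x\<in>F. x - c0) + (\<Sum>x\<in>F. c0) \<in> H"
      by (simp add: add_subgroup_add[OF H(1)])
    then have "y \<in> H" by (simp add: y flip: sum.distrib)
    moreover have "y \<in> distinct_sums k B"
      using F y by (auto simp: distinct_sums_def C_def)
    ultimately show "y \<in> distinct_sums k B \<inter> H" by blast
  qed
  moreover have "infinite ((\<lambda>c. \<Sum>F0 + c) ` (C - F0))"
    using c0 F0 by (subst finite_image_iff) (auto simp: C_def inj_on_def)
  ultimately show ?thesis by (metis finite_subset)
qed

section \<open>Construction of the set and its density\<close>

lemma upper_banach_density_ge:
  assumes \<Phi>: "folner \<Phi>" and ge: "\<And>N. real (card (A \<inter> \<Phi> N)) \<ge> c * real (card (\<Phi> N))"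
  shows "upper_banach_density A \<ge> ereal c"
proof -
  have "ereal c \<le> ereal (real (card (A \<inter> \<Phi> N)) / real (card (\<Phi> N)))" for N
  proof -
    have "card (\<Phi> N) > 0" using \<Phi> by (simp add: folner_def card_gt_0_iff)
    then show ?thesis using ge[of N] by (simp add: divide_simps)
  qed
  then have "ereal c \<le> liminf (\<lambda>N. ereal (real (card (A \<inter> \<Phi> N)) / real (card (\<Phi> N))))"
    by (intro Liminf_bounded) auto
  also have "\<dots> \<le> upper_density \<Phi> A"
    unfolding upper_density_def by (rule Liminf_le_Limsup) simp
  also have "\<dots> \<le> upper_banach_density A"
    unfolding upper_banach_density_def using \<Phi> by (intro SUP_upper) simp
  finally show ?thesis .
qed

theorem theorem1p3:
  fixes k :: nat
    and \<epsilon> :: real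
  assumes "k \<ge> 1"
    and "infinite_index (multiples k :: 'a::{ab_group_add, countable} set)"
    and "\<epsilon> > 0"
  shows "\<exists>A :: 'a set.
           upper_banach_density A > ereal (1 - \<epsilon>) \<and>
           (\<forall>B t. translate (distinct_sums k B) t \<subseteq> A \<longrightarrow> finite B)"
proof -
  obtain \<Phi> :: "nat \<Rightarrow> 'a set" where \<Phi>: "folner \<Phi>" using folner_exists by blast
  have fin: "finite (\<Phi> N)" for N using \<Phi> by (auto simp: folner_def)
  \<comment> \<open>These bounds sum to \<open>\<epsilon> / 2\<close>; the other half of
    \<open>\<epsilon>\<close> makes the final inequality strict.\<close>
  define \<eta> where "\<eta> n = \<epsilon> / 2 * (1 / 2) ^ Suc n" for n
  have \<eta>: "\<eta> n > 0" for n using assms(3) by (simp add: \<eta>_def)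
  \<comment> \<open>The demand \<open>M \<ge> n\<close> ensures that \<open>\<Phi> N\<close> can
    meet the \<open>n\<close>-th deleted set only for \<open>n \<le> N\<close>, so that a finite sum
    bounds the loss.\<close>
  have "\<exists>H M. add_subgroup H \<and> multiples k \<subseteq> H \<and> finite (range (translate H)) \<and> M \<ge> n \<and>
          (\<forall>N\<ge>M. real (card (\<Phi> N \<inter> translate H (from_nat n))) \<le> \<eta> n * real (card (\<Phi> N)))" for n
  proof -
    \<comment> \<open>With \<open>m\<close> disjoint translates the coset has density at most
      \<open>2 / m\<close>, which is below \<open>\<eta> n\<close>.\<close>
    obtain m :: nat where m: "2 / \<eta> n < real m" using reals_Archimedean2 by blast
    have mk: "nsmul k x \<in> multiples k" for x :: 'a by (auto simp: multiples_def)
    obtain H :: "'a set" and D where H: "add_subgroup H" "multiples k \<subseteq> H" "finite (range (translate H))"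
      and D: "finite D" "card D = m" "\<And>x y. x \<in> D \<Longrightarrow> y \<in> D \<Longrightarrow> x - y \<in> H \<Longrightarrow> x = y"
      using finite_index_subgroup_large[OF add_subgroup_multiples mk assms(1,2), of m] by blast
    obtain M where M: "\<And>N. N \<ge> M \<Longrightarrow>
        real m * real (card (\<Phi> N \<inter> translate H (from_nat n))) \<le> 2 * real (card (\<Phi> N))"
      using coset_density_le[OF \<Phi> H(1) D(1) D(3), of "from_nat n"] D(2)
      unfolding eventually_sequentially by auto
    have "real (card (\<Phi> N \<inter> translate H (from_nat n))) \<le> \<eta> n * real (card (\<Phi> N))" if "N \<ge> max M n" for N
    proof -
      let ?c = "real (card (\<Phi> N \<inter> translate H (from_nat n)))"
      have "2 * ?c \<le> (\<eta> n * real m) * ?c"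
        using m \<eta>[of n] by (intro mult_right_mono) (auto simp: field_simps)
      also have "\<dots> = \<eta> n * (real m * ?c)" by simp
      also have "\<dots> \<le> \<eta> n * (2 * real (card (\<Phi> N)))"
        using M[of N] that \<eta>[of n] by (intro mult_left_mono) auto
      finally show ?thesis by simp
    qed
    then show ?thesis using H by (intro exI[of _ H] exI[of _ "max M n"]) auto
  qed
  then obtain H :: "nat \<Rightarrow> 'a set" and M :: "nat \<Rightarrow> nat"
    where H: "\<And>n. add_subgroup (H n)" "\<And>n. multiples k \<subseteq> H n" "\<And>n. finite (range (translate (H n)))"
      and M: "\<And>n. M n \<ge> n"
      and dens: "\<And>n N. N \<ge> M n \<Longrightarrow>
        real (card (\<Phi> N \<inter> translate (H n) (from_nat n))) \<le> \<eta> n * real (card (\<Phi> N))"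
    by metis
  \<comment> \<open>Sparing the Folner sets before \<open>M n\<close> makes the density bound hold
    for every \<open>N\<close>, not just eventually.\<close>
  define E where "E n = translate (H n) (from_nat n) - (\<Union>N<M n. \<Phi> N)" for n
  define A where "A = - (\<Union>n. E n)"
  have card_E: "real (card (\<Phi> N \<inter> E n)) \<le> \<eta> n * real (card (\<Phi> N))" for n N
  proof (cases "N \<ge> M n")
    case True
    have "card (\<Phi> N \<inter> E n) \<le> card (\<Phi> N \<inter> translate (H n) (from_nat n))"
      using fin by (intro card_mono) (auto simp: E_def)
    then show ?thesis using dens[OF True] by linarith
  next
    case False
    then have "\<Phi> N \<inter> E n = {}" by (auto simp: E_def)
    then show ?thesis using \<eta>[of n] by simp
  qed
  have "real (card (A \<inter> \<Phi> N)) \<ge> (1 - \<epsilon> / 2) * real (card (\<Phi> N))" for N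
  proof -
    have "\<Phi> N - A \<subseteq> (\<Union>n\<le>N. \<Phi> N \<inter> E n)"
    proof
      fix y assume "y \<in> \<Phi> N - A"
      then obtain n where n: "y \<in> \<Phi> N" "y \<in> E n" by (auto simp: A_def)
      then have "\<not> N < M n" by (auto simp: E_def)
      then have "n \<le> N" using M[of n] by linarith
      then show "y \<in> (\<Union>n\<le>N. \<Phi> N \<inter> E n)" using n by auto
    qed
    then have "card (\<Phi> N - A) \<le> card (\<Union>n\<le>N. \<Phi> N \<inter> E n)"
      using fin by (intro card_mono) auto
    also have "\<dots> \<le> (\<Sum>n\<le>N. card (\<Phi> N \<inter> E n))" by (rule card_UN_le) simp
    finally have "real (card (\<Phi> N - A)) \<le> (\<Sum>n\<le>N. real (card (\<Phi> N \<inter> E n)))"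
      by (metis of_nat_le_iff of_nat_sum)
    also have "\<dots> \<le> (\<Sum>n\<le>N. \<eta> n * real (card (\<Phi> N)))" by (intro sum_mono card_E)
    also have "\<dots> = (\<Sum>n\<le>N. \<eta> n) * real (card (\<Phi> N))" by (simp add: sum_distrib_right)
    also have "(\<Sum>n\<le>N. \<eta> n) = \<epsilon> / 2 * (1 - (1 / 2) ^ Suc N)"
      by (induction N) (auto simp: \<eta>_def field_simps)
    also have "\<dots> * real (card (\<Phi> N)) \<le> \<epsilon> / 2 * real (card (\<Phi> N))"
      using assms(3) by (intro mult_right_mono) auto
    finally have "real (card (\<Phi> N - A)) \<le> \<epsilon> / 2 * real (card (\<Phi> N))" .
    moreover have "card (\<Phi> N) = card (A \<inter> \<Phi> N) + card (\<Phi> N - A)"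
      using card_Int_Diff[OF fin[of N], of A] by (simp add: Int_commute)
    ultimately show ?thesis by (simp add: algebra_simps)
  qed
  then have "upper_banach_density A \<ge> ereal (1 - \<epsilon> / 2)"
    by (rule upper_banach_density_ge[OF \<Phi>])
  moreover have "ereal (1 - \<epsilon>) < ereal (1 - \<epsilon> / 2)" using assms(3) by simp
  ultimately have "upper_banach_density A > ereal (1 - \<epsilon>)" by (rule less_le_trans[rotated])
  moreover have "finite B" if sub: "translate (distinct_sums k B) t \<subseteq> A" for B t
  proof (rule ccontr)
    assume B: "infinite B"
    \<comment> \<open>For this \<open>n\<close> the deleted coset is that of \<open>t\<close>. Sums
      in \<open>H n\<close> shifted by \<open>t\<close> lie in it, and being in \<open>A\<close>
      they are confined to its finite spared part.\<close>
    define n where "n = to_nat t"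
    have "translate (distinct_sums k B \<inter> H n) t \<subseteq> (\<Union>N<M n. \<Phi> N)"
    proof
      fix y assume y: "y \<in> translate (distinct_sums k B \<inter> H n) t"
      then have "y \<in> A" using sub by (auto simp: translate_mem_iff)
      moreover have "y \<in> translate (H n) (from_nat n)"
        using y by (simp add: translate_mem_iff n_def)
      ultimately show "y \<in> (\<Union>N<M n. \<Phi> N)" by (auto simp: A_def E_def)
    qed
    then have "finite (translate (distinct_sums k B \<inter> H n) t)"
      using fin by (meson finite_UN_I finite_lessThan finite_subset)
    then have "finite (distinct_sums k B \<inter> H n)"
      unfolding translate_def by (subst (asm) finite_image_iff) (auto simp: inj_on_def)
    then show False
      using infinite_sums_in_subgroup[OF H(1) H(3) H(2) assms(1) B] by blast
  qed
  ultimately show ?thesis by blast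
qed

end
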